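(* Let $(\mathcal{X},\|\cdot\|)$ be a finite-dimensional real normed vector space and let $T:\mathcal{X}\to\mathcal{X}$ be a nonexpansive map. Let $\mathrm{Fix}:\mathcal{X}\rightrightarrows\mathcal{X}$ be the set-valued mapping $\mathrm{Fix}(g)=\{x\in\mathcal{X}\mid g+T(x)=x\}$. Then the set of points $g\in\operatorname{int}(\operatorname{dom}(\mathrm{Fix}))$ where $g+T$ fails to have a unique fixed point is meager in $\operatorname{int}(\operatorname{dom}(\mathrm{Fix}))$. In particular, when $\operatorname{dom}(\mathrm{Fix})=\mathcal{X}$, the set of points $g\in\mathcal{X}$ where $g+T$ has a unique fixed point is dense in $\mathcal{X}$.
   Context: A map $T:\mathcal{X}\to\mathcal{X}$ is nonexpansive if $\|T(x)-T(y)\|\leq\|x-y\|$ for all $x,y\in\mathcal{X}$. For a set-valued mapping $A$, $\operatorname{dom}(A)=\{x\mid A(x)\neq\emptyset\}$; $\operatorname{int}$ denotes the interior. A subset of $\mathcal{W}\subset\mathcal{X}$ is meager in $\mathcal{W}$ if it is a countable union of sets that are nowhere dense in $\mathcal{W}$ (closure relative to $\mathcal{W}$ has empty interior relative to $\mathcal{W}$). *)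

theory Defs
  imports "HOL-Analysis.Analysis"
begin

definition nonexpansive :: "('a::real_normed_vector \<Rightarrow> 'a) \<Rightarrow> bool" where
  "nonexpansive T \<longleftrightarrow> (\<forall>x y. norm (T x - T y) \<le> norm (x - y))"

definition sv_dom :: "('a \<Rightarrow> 'b set) \<Rightarrow> 'a set" where
  "sv_dom A = {x. A x \<noteq> {}}"

definition Fix :: "('a::real_normed_vector \<Rightarrow> 'a) \<Rightarrow> 'a \<Rightarrow> 'a set" where
  "Fix T g = {x. g + T x = x}"

definition nowhere_dense_in :: "'a::topological_space set \<Rightarrow> 'a set \<Rightarrow> bool" where
  "nowhere_dense_in W N \<longleftrightarrow>
     N \<subseteq> W \<and> top_of_set W interior_of (top_of_set W closure_of N) = {}"

definition meager_in :: "'a::topological_space set \<Rightarrow> 'a set \<Rightarrow> bool" where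
  "meager_in W S \<longleftrightarrow>
     (\<exists>\<N>. countable \<N> \<and> (\<forall>N\<in>\<N>. nowhere_dense_in W N) \<and> S = \<Union>\<N>)"

end

theory Submission
  imports Defs
begin

text \<open>
  The residual map \<^term>\<open>\<lambda>x. x - T x\<close> of a nonexpansive map is accretive. Hence, if \<open>x\<close> and \<open>y\<close> are
  both fixed points of \<open>g + T\<close> and \<open>x'\<close> is a fixed point of \<open>g - t (x - y) + T\<close> with \<open>t > 0\<close>, then
  \<open>x'\<close> is at least as close to \<open>y\<close> as it is to \<open>x\<close>. Consequently, for two balls that are small
  compared to their distance, the parameters \<open>g\<close> whose fixed point set meets both balls form a
  closed set without interior: moving \<open>g\<close> slightly in the direction \<open>y - x\<close> expels the fixed points
  from the ball around \<open>x\<close>. Countably many pairs of balls detect all failures of uniqueness.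
\<close>

section \<open>Compactness of closed balls in finite dimension\<close>

lemma compact_cball_finite_dimensional:
  fixes a :: "'a::real_normed_vector"
  assumes "\<exists>B. finite_dimensional_vector_space (scaleR :: real \<Rightarrow> 'a \<Rightarrow> 'a) B"
  shows "compact (cball a r)"
proof -
  obtain B where "finite_dimensional_vector_space (scaleR :: real \<Rightarrow> 'a \<Rightarrow> 'a) B"
    using assms by blast
  then interpret fd: finite_dimensional_vector_space "scaleR :: real \<Rightarrow> 'a \<Rightarrow> 'a" B .
  define \<phi> where "\<phi> = (\<lambda>c::'a \<Rightarrow> real. \<Sum>b\<in>B. c b *\<^sub>R b)"
  \<comment> \<open>Coefficient families are functions on the whole type, so boxes are compact in
    the product topology by Tychonoff, while \<open>\<phi>\<close> reads only the coordinates in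
    \<open>B\<close>.\<close>
  define box where "box = (\<lambda>M::real. Pi\<^sub>E (UNIV::'a set) (\<lambda>_. {-M..M}))"
  have box: "compact (box M)" for M
  proof -
    have "compactin (product_topology (\<lambda>_. euclidean) UNIV) (box M)"
      unfolding box_def compactin_PiE by auto
    then show ?thesis
      by (simp add: euclidean_product_topology)
  qed
  have coord: "continuous_on A (\<lambda>c::'a \<Rightarrow> real. c b)" for A b
    by (rule continuous_on_subset[OF continuous_on_product_coordinates subset_UNIV])
  have \<phi>: "continuous_on A \<phi>" for A
    unfolding \<phi>_def by (intro continuous_intros coord)
  \<comment> \<open>The unit sphere of the l1 norm on coefficients; the intersection with
    \<open>box 1\<close> also bounds the coordinates outside \<open>B\<close> and so makes it
    compact. Linear independence keeps 0 out of its image, and the gap \<open>\<delta>\<close>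
    becomes the constant in the norm comparison.\<close>
  define S where "S = box 1 \<inter> {c. (\<Sum>b\<in>B. \<bar>c b\<bar>) = 1}"
  have "closed {c. (\<Sum>b\<in>B. \<bar>c b\<bar>) = (1::real)}"
    by (intro closed_Collect_eq continuous_intros coord)
  then have "compact S"
    unfolding S_def using box by (intro compact_Int_closed)
  then have "closed (\<phi> ` S)"
    using \<phi> compact_continuous_image compact_imp_closed by blast
  moreover have "0 \<notin> \<phi> ` S"
  proof
    assume "0 \<in> \<phi> ` S"
    then obtain c where "c \<in> S" "(\<Sum>b\<in>B. c b *\<^sub>R b) = 0"
      unfolding \<phi>_def by auto
    then have "\<forall>b\<in>B. c b = 0"
      using fd.independent_Basis fd.finite_Basis by (simp add: fd.independent_explicit)
    then show False
      using \<open>c \<in> S\<close> by (simp add: S_def)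
  qed
  ultimately obtain \<delta> where \<delta>: "\<delta> > 0" "ball 0 \<delta> \<subseteq> - \<phi> ` S"
    by (metis ComplI open_Compl open_contains_ball)
  \<comment> \<open>Homogeneity: dividing by the l1 norm \<open>s\<close> lands in \<open>S\<close>.
    Vanishing off \<open>B\<close> ensures that the rescaled family stays in
    \<open>box 1\<close>.\<close>
  have bound: "norm (\<phi> c) \<ge> \<delta> * (\<Sum>b\<in>B. \<bar>c b\<bar>)" if c: "\<And>b. b \<notin> B \<Longrightarrow> c b = 0" for c
  proof (cases "(\<Sum>b\<in>B. \<bar>c b\<bar>) = 0")
    case False
    define s where "s = (\<Sum>b\<in>B. \<bar>c b\<bar>)"
    have s: "s > 0"
      using False unfolding s_def by (metis abs_ge_zero less_eq_real_def sum_nonneg)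
    have le: "\<bar>c b\<bar> \<le> s" for b
    proof (cases "b \<in> B")
      case True
      then show ?thesis
        unfolding s_def using fd.finite_Basis by (intro member_le_sum) auto
    qed (use c s in simp)
    define d where "d = (\<lambda>b. c b / s)"
    have "\<bar>d b\<bar> \<le> 1" for b
      using le[of b] s by (simp add: d_def)
    moreover have "(\<Sum>b\<in>B. \<bar>d b\<bar>) = 1"
      using s by (simp add: d_def flip: sum_divide_distrib s_def)
    ultimately have "d \<in> S"
      unfolding S_def box_def by (auto simp: PiE_UNIV_domain abs_le_iff minus_le_iff)
    then have "\<phi> d \<notin> ball 0 \<delta>"
      using \<delta> by auto
    moreover have "\<phi> d = (1 / s) *\<^sub>R \<phi> c"
      by (simp add: \<phi>_def d_def scaleR_sum_right)
    ultimately show ?thesis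
      using s by (simp add: field_simps flip: s_def)
  qed simp
  \<comment> \<open>Points of the ball have norm at most \<open>norm a + r\<close>, so
    \<open>bound\<close> limits each coefficient. The ball is then a closed subset of the compact
    image of a box.\<close>
  have "cball a r \<subseteq> \<phi> ` box ((norm a + r) / \<delta>)"
  proof
    fix x assume x: "x \<in> cball a r"
    have "x \<in> span B"
      using fd.span_Basis by (simp add: span_raw_def)
    then obtain u where u: "x = (\<Sum>b\<in>B. u b *\<^sub>R b)"
      using span_finite[OF fd.finite_Basis] by auto
    define c where "c = (\<lambda>b. if b \<in> B then u b else 0)"
    have c: "x = \<phi> c"
      by (simp add: u \<phi>_def c_def)
    have "norm x \<le> norm a + r"
      using x norm_triangle_ineq2[of x a] by (simp add: dist_norm norm_minus_commute)
    then have "\<delta> * (\<Sum>b\<in>B. \<bar>c b\<bar>) \<le> norm a + r"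
      using bound[of c] by (simp add: c c_def)
    then have sum: "(\<Sum>b\<in>B. \<bar>c b\<bar>) \<le> (norm a + r) / \<delta>"
      using \<delta> by (simp add: field_simps)
    have "\<bar>c b\<bar> \<le> (\<Sum>b\<in>B. \<bar>c b\<bar>)" for b
    proof (cases "b \<in> B")
      case True
      then show ?thesis
        using fd.finite_Basis by (intro member_le_sum) auto
    qed (simp add: c_def sum_nonneg)
    then have "\<bar>c b\<bar> \<le> (norm a + r) / \<delta>" for b
      using sum order_trans by blast
    then have "c \<in> box ((norm a + r) / \<delta>)"
      unfolding box_def by (auto simp: PiE_UNIV_domain abs_le_iff minus_le_iff)
    then show "x \<in> \<phi> ` box ((norm a + r) / \<delta>)"
      using c by blast
  qed
  moreover have "compact (\<phi> ` box ((norm a + r) / \<delta>))"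
    using \<phi> box compact_continuous_image by blast
  ultimately show ?thesis
    by (metis closed_cball compact_Int_closed inf.absorb_iff2)
qed

text \<open>Balls of integer radius about \<open>a\<close> exhaust the space and each is totally
  bounded. The resulting nets later supply the centres of the pairs of balls.\<close>

lemma countable_ball_cover_of_compact_cballs:
  fixes a :: "'a::metric_space"
  assumes "\<And>r. compact (cball a r)" and "e > 0"
  shows "\<exists>Q::'a set. countable Q \<and> (\<Union>q\<in>Q. ball q e) = UNIV"
proof -
  have "\<exists>k. finite k \<and> cball a (real n) \<subseteq> (\<Union>x\<in>k. ball x e)" for n
    using assms unfolding compact_eq_totally_bounded by blast
  then obtain k where k: "\<And>n. finite (k n)" "\<And>n. cball a (real n) \<subseteq> (\<Union>x\<in>k n. ball x e)"
    by metis
  have "(\<Union>q\<in>(\<Union>n. k n). ball q e) = UNIV"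
  proof (rule UNIV_eq_I[symmetric])
    fix x
    have "x \<in> cball a (real (nat \<lceil>dist a x\<rceil>))"
      using real_nat_ceiling_ge by simp
    then show "x \<in> (\<Union>q\<in>(\<Union>n. k n). ball q e)"
      using k(2) by blast
  qed
  moreover have "countable (\<Union>n. k n)"
    using k(1) by (simp add: countable_finite)
  ultimately show ?thesis
    by metis
qed

section \<open>Accretivity and the displacement of fixed points\<close>

lemma nonexpansive_accretive:
  assumes "nonexpansive T" and "s \<ge> 0"
  shows "norm (x - y) \<le> norm ((x - y) + s *\<^sub>R ((x - T x) - (y - T y)))"
proof -
  \<comment> \<open>The vector on the right equals \<open>(1 + s)(x - y) - s (T x - T y)\<close>.
    Nonexpansiveness lets the subtracted term cancel at most the surplus
    \<open>s * norm (x - y)\<close> of the first.\<close>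
  have "norm (s *\<^sub>R (T x - T y)) \<le> s * norm (x - y)"
    using assms by (simp add: nonexpansive_def mult_left_mono)
  moreover have "norm ((1 + s) *\<^sub>R (x - y)) = norm (x - y) + s * norm (x - y)"
    using assms(2) by (simp only: norm_scaleR) (simp add: algebra_simps)
  ultimately have "norm (x - y) \<le> norm ((1 + s) *\<^sub>R (x - y)) - norm (s *\<^sub>R (T x - T y))"
    by simp
  also have "\<dots> \<le> norm ((1 + s) *\<^sub>R (x - y) - s *\<^sub>R (T x - T y))"
    by (rule norm_triangle_ineq2)
  also have "(1 + s) *\<^sub>R (x - y) - s *\<^sub>R (T x - T y)
      = (x - y) + s *\<^sub>R ((x - T x) - (y - T y))"
    by (simp add: algebra_simps)
  finally show ?thesis .
qed

text \<open>Accretivity is applied to \<open>x'\<close> and \<open>y\<close> with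
  \<open>s = 1 / t\<close>: this scales the residual difference \<open>-t (x - y)\<close> to
  \<open>-(x - y)\<close>, and adding \<open>x' - y\<close> leaves \<open>x' - x\<close>.\<close>

lemma Fix_perturbed_closer:
  assumes "nonexpansive T" and "x \<in> Fix T g" "y \<in> Fix T g"
    and "x' \<in> Fix T (g - t *\<^sub>R (x - y))" and "t > 0"
  shows "norm (x' - y) \<le> norm (x' - x)"
proof -
  have "(x' - T x') - (y - T y) = - t *\<^sub>R (x - y)"
  proof -
    have "x' - T x' = g - t *\<^sub>R (x - y)" "y - T y = g"
      using assms(3,4) by (metis (mono_tags) Fix_def add_diff_cancel_right' mem_Collect_eq)+
    then show ?thesis
      by simp
  qed
  then have "(x' - y) + (1 / t) *\<^sub>R ((x' - T x') - (y - T y)) = x' - x"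
    using \<open>t > 0\<close> by simp
  then show ?thesis
    using nonexpansive_accretive[OF assms(1), of "1 / t" x' y] \<open>t > 0\<close> by (simp only:) simp
qed

lemma interior_two_cluster_parameters:
  assumes "nonexpansive T" and far: "4 * r < dist p q"
  shows "interior {g. Fix T g \<inter> cball p r \<noteq> {} \<and> Fix T g \<inter> cball q r \<noteq> {}} = {}"
proof (rule ccontr)
  define N where "N = {g. Fix T g \<inter> cball p r \<noteq> {} \<and> Fix T g \<inter> cball q r \<noteq> {}}"
  assume "\<not> ?thesis"
  then obtain g e where e: "e > 0" "ball g e \<subseteq> N"
    by (metis N_def ex_in_conv mem_interior)
  then have "g \<in> N"
    by auto
  then obtain x y where x: "x \<in> Fix T g" "x \<in> cball p r" and y: "y \<in> Fix T g" "y \<in> cball q r"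
    unfolding N_def by auto
  \<comment> \<open>Chosen so that the shift \<open>t (x - y)\<close> is shorter than
    \<open>e\<close>; the \<open>+ 1\<close> keeps the denominator positive without a case
    distinction.\<close>
  define t where "t = e / (2 * (norm (x - y) + 1))"
  have n1: "norm (x - y) + 1 > 0"
    by (simp add: add_nonneg_pos)
  have t: "t > 0"
    using e n1 by (simp add: t_def)
  have "t * norm (x - y) < t * (2 * (norm (x - y) + 1))"
    using t by (intro mult_strict_left_mono) (simp_all add: add_nonneg_pos)
  also have "\<dots> = e"
    using n1 by (simp add: t_def)
  finally have "g - t *\<^sub>R (x - y) \<in> ball g e"
    using t by (simp add: dist_norm)
  then obtain x' where x': "x' \<in> Fix T (g - t *\<^sub>R (x - y))" "x' \<in> cball p r"
    using e unfolding N_def by blast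
  \<comment> \<open>Both \<open>x\<close> and \<open>x'\<close> lie in the ball around
    \<open>p\<close>, so \<open>dist x' x\<close> is at most \<open>2 * r\<close>, and hence so is
    \<open>dist x' y\<close>. Passing from \<open>p\<close> to \<open>q\<close> through
    \<open>x'\<close> and \<open>y\<close> then costs at most \<open>4 * r\<close>, against
    \<open>far\<close>.\<close>
  have "dist x' y \<le> dist x' x"
    using Fix_perturbed_closer[OF assms(1) x(1) y(1) x'(1) t] by (simp add: dist_norm)
  moreover have "dist p q \<le> dist p x' + dist x' y + dist q y"
    by metric
  moreover have "dist x' x \<le> dist p x' + dist p x"
    by metric
  ultimately show False
    using x(2) y(2) x'(2) far by simp
qed

section \<open>Closedness, relative nowhere density and Baire category\<close>

lemma closed_parameters_meeting_compact:
  assumes "nonexpansive T" and "compact K"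
  shows "closed {g. Fix T g \<inter> K \<noteq> {}}"
proof -
  have "continuous_on UNIV T"
    using assms(1) unfolding nonexpansive_def continuous_on_iff dist_norm
    by (meson order_le_less_trans)
  then have "continuous_on K (\<lambda>x. x - T x)"
    by (intro continuous_intros) (auto intro: continuous_on_subset)
  then have "closed ((\<lambda>x. x - T x) ` K)"
    using assms(2) compact_continuous_image compact_imp_closed by blast
  \<comment> \<open>Solving \<open>g + T x = x\<close> for \<open>g\<close> identifies these
    parameters with the residuals of points of \<open>K\<close>, a continuous image of a compact
    set.\<close>
  moreover have "{g. Fix T g \<inter> K \<noteq> {}} = (\<lambda>x. x - T x) ` K"
    by (auto simp: Fix_def algebra_simps image_iff)
  ultimately show ?thesis
    by simp
qed

text \<open>Relatively open subsets of an open \<open>W\<close> are open in the whole space, so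
  emptiness of the ordinary interior passes to the relative one.\<close>

lemma nowhere_dense_in_open:
  assumes "open W" "closed C" "interior C = {}"
  shows "nowhere_dense_in W (W \<inter> C)"
proof -
  have "top_of_set W closure_of (W \<inter> C) = W \<inter> C"
    using assms(2) by (simp add: closure_of_eq closedin_closed_Int)
  moreover have "top_of_set W interior_of (W \<inter> C) = {}"
  proof -
    have "openin (top_of_set W) U \<Longrightarrow> U \<subseteq> W \<inter> C \<Longrightarrow> U = {}" for U
      using assms by (metis inf.bounded_iff interior_maximal openin_open_eq subset_empty)
    then show ?thesis
      by (metis interior_of_subset openin_interior_of)
  qed
  ultimately show ?thesis
    by (simp add: nowhere_dense_in_def)
qed

text \<open>Compact closed balls make the space locally compact, and Baire's theorem for locally
  compact regular spaces applies to the closures of the nowhere dense pieces.\<close>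

lemma meager_in_UNIV_dense_Compl:
  fixes S :: "'a::real_normed_vector set"
  assumes "meager_in UNIV S" and "\<And>a r. compact (cball (a::'a) r)"
  shows "closure (- S) = UNIV"
proof -
  obtain \<N> where \<N>: "countable \<N>" "\<And>N. N \<in> \<N> \<Longrightarrow> interior (closure N) = {}" "S = \<Union>\<N>"
    using assms(1) unfolding meager_in_def nowhere_dense_in_def by auto
  have "locally_compact_space (euclidean :: 'a topology)"
    unfolding locally_compact_space_def
  proof
    fix x :: 'a
    show "\<exists>U K. openin euclidean U \<and> compactin euclidean K \<and> x \<in> U \<and> U \<subseteq> K"
      using assms(2)[of x 1]
      by (intro exI[of _ "ball x 1"] exI[of _ "cball x 1"]) auto
  qed
  moreover have "regular_space (euclidean :: 'a topology)"
    by (simp add: metrizable_imp_regular_space metrizable_space_euclidean)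
  ultimately have "euclidean interior_of \<Union>(closure ` \<N>) = {}"
    using \<N> by (intro Baire_category_alt) auto
  then have "interior (\<Union>(closure ` \<N>)) = {}"
    by simp
  moreover have "S \<subseteq> \<Union>(closure ` \<N>)"
    using \<N>(3) closure_subset by fastforce
  ultimately have "interior S = {}"
    using interior_mono by blast
  then show ?thesis
    by (simp add: closure_complement)
qed

section \<open>The exceptional parameters as a countable union\<close>

lemma meager_in_nonunique_parameters:
  fixes T :: "'a::real_normed_vector \<Rightarrow> 'a"
  assumes nonexp: "nonexpansive T" and compact: "\<And>a r. compact (cball (a::'a) r)"
    and W: "open W" "W \<subseteq> sv_dom (Fix T)"
  shows "meager_in W {g \<in> W. \<not> (\<exists>!x. g + T x = x)}"
proof -
  have "\<exists>Q::'a set. countable Q \<and> (\<Union>q\<in>Q. ball q (inverse (real (Suc n)))) = UNIV" for n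
    by (rule countable_ball_cover_of_compact_cballs[OF compact]) simp
  then obtain Q :: "nat \<Rightarrow> 'a set" where Q: "\<And>n. countable (Q n)"
    "\<And>n. (\<Union>q\<in>Q n. ball q (inverse (real (Suc n)))) = UNIV"
    by metis
  define C where "C = (\<lambda>p q r. {g. Fix T g \<inter> cball p r \<noteq> {} \<and> Fix T g \<inter> cball q r \<noteq> {}})"
  define \<N> where "\<N> = (\<lambda>(n, p, q). W \<inter> C p q (inverse (real (Suc n)))) `
    {(n, p, q). p \<in> Q n \<and> q \<in> Q n \<and> 4 * inverse (real (Suc n)) < dist p q}"
  have "countable \<N>"
  proof -
    have "countable (SIGMA n:UNIV. Q n \<times> Q n)"
      using Q(1) by (intro countable_SIGMA) auto
    then have "countable {(n, p, q). p \<in> Q n \<and> q \<in> Q n \<and> 4 * inverse (real (Suc n)) < dist p q}"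
      by (rule countable_subset[rotated]) auto
    then show ?thesis
      unfolding \<N>_def by simp
  qed
  moreover have "nowhere_dense_in W N" if "N \<in> \<N>" for N
  proof -
    obtain n p q where N: "N = W \<inter> C p q (inverse (real (Suc n)))"
      and far: "4 * inverse (real (Suc n)) < dist p q"
      using \<open>N \<in> \<N>\<close> unfolding \<N>_def by auto
    have "closed (C p q (inverse (real (Suc n))))"
      unfolding C_def
      by (intro closed_Collect_conj closed_parameters_meeting_compact nonexp compact)
    then show ?thesis
      unfolding N using W(1) interior_two_cluster_parameters[OF nonexp far]
      by (intro nowhere_dense_in_open) (auto simp: C_def)
  qed
  moreover have "{g \<in> W. \<not> (\<exists>!x. g + T x = x)} = \<Union>\<N>"
  proof (intro equalityI subsetI)
    fix g assume g: "g \<in> {g \<in> W. \<not> (\<exists>!x. g + T x = x)}"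
    then obtain x where x: "x \<in> Fix T g"
      using W(2) unfolding sv_dom_def by blast
    then obtain y where y: "y \<in> Fix T g" "x \<noteq> y"
      using g by (auto simp: Fix_def)
    \<comment> \<open>The factor 6 is 4 + 2: replacing \<open>x\<close> and \<open>y\<close> by net
      points loses less than two radii, which leaves more than four between the centres.\<close>
    then obtain n where n: "inverse (real (Suc n)) < dist x y / 6"
      using reals_Archimedean[of "dist x y / 6"] by auto
    obtain p q where p: "p \<in> Q n" "x \<in> ball p (inverse (real (Suc n)))"
      and q: "q \<in> Q n" "y \<in> ball q (inverse (real (Suc n)))"
      using Q(2)[of n] by blast
    have "dist x y \<le> dist p x + dist p q + dist q y"
      by metric
    then have "4 * inverse (real (Suc n)) < dist p q"
      using n p(2) q(2) unfolding mem_ball by linarith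
    then have "W \<inter> C p q (inverse (real (Suc n))) \<in> \<N>"
      unfolding \<N>_def using p(1) q(1) by (intro image_eqI[of _ _ "(n, p, q)"]) auto
    moreover have "g \<in> W \<inter> C p q (inverse (real (Suc n)))"
      using g x y(1) p(2) q(2) ball_subset_cball unfolding C_def by blast
    ultimately show "g \<in> \<Union>\<N>"
      by blast
  next
    fix g assume "g \<in> \<Union>\<N>"
    then obtain n p q where g: "g \<in> W" "g \<in> C p q (inverse (real (Suc n)))"
      and far: "4 * inverse (real (Suc n)) < dist p q"
      unfolding \<N>_def by auto
    then obtain x y where x: "x \<in> Fix T g" "dist p x \<le> inverse (real (Suc n))"
      and y: "y \<in> Fix T g" "dist q y \<le> inverse (real (Suc n))"
      unfolding C_def by auto
    \<comment> \<open>\<open>meager_in\<close> asks for equality with the union, so each piece must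
      contain only exceptional parameters. A point common to both balls would put their centres
      within two radii of each other.\<close>
    have "x \<noteq> y"
    proof
      assume "x = y"
      then have "dist p q \<le> dist p x + dist q y"
        using dist_triangle2 by blast
      moreover have "inverse (real (Suc n)) > 0"
        by simp
      ultimately show False
        using far x(2) y(2) by linarith
    qed
    then show "g \<in> {g \<in> W. \<not> (\<exists>!x. g + T x = x)}"
      using g x y by (auto simp: Fix_def)
  qed
  ultimately show ?thesis
    unfolding meager_in_def by blast
qed

theorem theorem4p7:
  fixes T :: "'a::real_normed_vector \<Rightarrow> 'a"
  assumes findim: "\<exists>B. finite_dimensional_vector_space (scaleR :: real \<Rightarrow> 'a \<Rightarrow> 'a) B"
    and nonexp: "nonexpansive T"
  shows "meager_in (interior (sv_dom (Fix T)))
           {g \<in> interior (sv_dom (Fix T)). \<not> (\<exists>!x. g + T x = x)}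
         \<and> (sv_dom (Fix T) = UNIV \<longrightarrow> closure {g. \<exists>!x. g + T x = x} = UNIV)"
proof (intro conjI impI)
  note compact = compact_cball_finite_dimensional[OF findim]
  show "meager_in (interior (sv_dom (Fix T)))
      {g \<in> interior (sv_dom (Fix T)). \<not> (\<exists>!x. g + T x = x)}"
    by (intro meager_in_nonunique_parameters nonexp compact open_interior interior_subset)
  assume "sv_dom (Fix T) = UNIV"
  then have "meager_in UNIV {g \<in> UNIV. \<not> (\<exists>!x. g + T x = x)}"
    by (intro meager_in_nonunique_parameters nonexp compact) auto
  then have "closure (- {g \<in> UNIV. \<not> (\<exists>!x. g + T x = x)}) = UNIV"
    using compact by (rule meager_in_UNIV_dense_Compl)
  then show "closure {g. \<exists>!x. g + T x = x} = UNIV"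
    by (simp add: Compl_eq)
qed

end
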